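(* Let $s$ be a positive integer and let $\mathcal{H}$ be a nonempty $s$-uniform hypergraph. Suppose that $\alpha, \beta, q \in (0,1)$ and $E \geq v(\mathcal{H})$ are such that $\alpha \beta q \cdot v(\mathcal{H}) \geq 10^9 s^7$ and $10^4 s^5 q \leq \beta$ and, for every $t \in \{2, \dotsc, s\}$, \[ \Delta_t(\mathcal{H}) \leq \left(\frac{q}{10^6 s^5}\right)^{t-1} \cdot \frac{E}{v(\mathcal{H})}. \] Then there is a family $\mathcal{C} \subseteq \mathcal{P}(V(\mathcal{H}))$ of at most $\exp\left(10^4 s^5 \beta^{-1} \log(e/\alpha) \cdot q \log(e/q) \cdot v(\mathcal{H})\right)$ sets such that: (i) For every $I \in \mathcal{I}(\mathcal{H})$, there is a $C \in \mathcal{C}$ such that $I \subseteq C$. (ii) For every $C \in \mathcal{C}$, either $|C| \leq \alpha v(\mathcal{H})$ or there is a subset $W \subseteq C$ with $|W| \geq (1-\beta)|C|$ such that $e(\mathcal{H}[W]) < E$.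
   Context: All hypergraphs are finite. A hypergraph is $s$-uniform if each of its edges is a set of exactly $s$ vertices; edges may have positive integer multiplicities, and edges are always counted with multiplicity. $v(\mathcal{H})$ and $e(\mathcal{H})$ are the numbers of vertices and edges of $\mathcal{H}$; $\mathcal{H}$ is nonempty if it has at least one edge. For $T \subseteq V(\mathcal{H})$, $\deg_{\mathcal{H}} T$ is the number of edges of $\mathcal{H}$ containing $T$, and $\Delta_t(\mathcal{H}) = \max\{\deg_{\mathcal{H}} T : T \subseteq V(\mathcal{H}),\ |T| = t\}$. $\mathcal{I}(\mathcal{H})$ is the family of independent sets of $\mathcal{H}$ (subsets of $V(\mathcal{H})$ containing no edge). $\mathcal{H}[W]$ is the subhypergraph of $\mathcal{H}$ induced by $W$, comprising all edges contained in $W$. $\mathcal{P}(X)$ is the power set of $X$. $E$ is a real number, $\log$ is the natural logarithm, and $e$ in $\log(e/\alpha)$, $\log(e/q)$ is Euler's number. *)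

theory Defs
  imports Complex_Main "HOL-Library.Multiset"
begin

text \<open>The edges form a multiset, so that edges may be repeated and are always counted with
  multiplicity.\<close>

record 'a hypergraph =
  vertices :: "'a set"
  edges :: "'a set multiset"

definition hypergraph :: "'a hypergraph \<Rightarrow> bool" where
  "hypergraph H \<longleftrightarrow> finite (vertices H) \<and> (\<forall>A \<in># edges H. A \<subseteq> vertices H)"

definition uniform_hypergraph :: "nat \<Rightarrow> 'a hypergraph \<Rightarrow> bool" where
  "uniform_hypergraph s H \<longleftrightarrow> hypergraph H \<and> (\<forall>A \<in># edges H. card A = s)"

definition num_vertices :: "'a hypergraph \<Rightarrow> nat" where
  "num_vertices H = card (vertices H)"

definition num_edges :: "'a hypergraph \<Rightarrow> nat" where
  "num_edges H = size (edges H)"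

definition nonempty_hypergraph :: "'a hypergraph \<Rightarrow> bool" where
  "nonempty_hypergraph H \<longleftrightarrow> num_edges H \<ge> 1"

definition degree :: "'a hypergraph \<Rightarrow> 'a set \<Rightarrow> nat" where
  "degree H T = size {#A \<in># edges H. T \<subseteq> A#}"

text \<open>The maximum is over a nonempty set exactly when \<open>t \<le> num_vertices H\<close>; this holds whenever
  \<open>t\<close> is at most the uniformity of a nonempty uniform hypergraph.\<close>

definition max_degree :: "nat \<Rightarrow> 'a hypergraph \<Rightarrow> nat" where
  "max_degree t H = Max {degree H T |T. T \<subseteq> vertices H \<and> card T = t}"

definition independent_sets :: "'a hypergraph \<Rightarrow> 'a set set" where
  "independent_sets H = {I. I \<subseteq> vertices H \<and> (\<forall>A \<in># edges H. \<not> A \<subseteq> I)}"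

definition induced :: "'a hypergraph \<Rightarrow> 'a set \<Rightarrow> 'a hypergraph" where
  "induced H W = \<lparr>vertices = W, edges = {#A \<in># edges H. A \<subseteq> W#}\<rparr>"

end

theory Submission
  imports Defs "HOL-Analysis.Henstock_Kurzweil_Integration"
begin

text \<open>Almost independence of a container \<open>C\<close> is measured by the probability that a random subset of
  \<open>C\<close>, containing each element independently with probability \<open>q\<close>, is independent. The
  argument has two halves.

  First, the independent sets of an arbitrary hypergraph, indeed the members of an arbitrary
  down-closed family \<open>F\<close>, are covered by few sets \<open>C\<close> for which this probability is at least
  \<open>exp (- g * card C)\<close> (lemma \<open>containers_by_independence_probability\<close>). An unknown
  \<open>I \<in> F\<close> is located by asking, vertex by vertex, whether \<open>v \<in> I\<close>. After some
  questions it is known that \<open>T \<subseteq> I \<subseteq> C\<close>, so only the sets \<open>R \<subseteq> C\<close> with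
  \<open>R \<union> T \<in> F\<close> matter. Their generating function, the partition function of a hard-core model, is
  \<open>Z x = (\<Sum>R. x ^ card R)\<close>, and the integral of \<open>ln (Z (exp t - 1))\<close> over
  \<open>0 \<le> t \<le> u\<close>, where \<open>u = - ln (1 - q)\<close>, is a potential that never increases. A positive answer for \<open>v\<close> replaces \<open>T\<close> by
  \<open>insert v T\<close>, and the decreases of the potential, summed over all \<open>v \<in> C\<close>, amount to at least
  minus the logarithm of the independence probability (lemma \<open>sum_potential_drop\<close>). Hence,
  while this probability is small, some \<open>v\<close> makes the potential drop by \<open>g\<close> when the answer is
  positive. The initial potential is at most \<open>card V * u\<^sup>2\<close>, so there are few positive
  answers, and few containers.

  Second, Janson's inequality shows that a set \<open>C\<close> with a large independence probability satisfies
  the required conclusion. If every large \<open>W \<subseteq> C\<close> contained at least \<open>E\<close> edges, then one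
  could choose at least \<open>E\<close> edges inside \<open>C\<close> with all vertex degrees of order \<open>s * E / (\<beta> * card C)\<close>
  (lemma \<open>ex_dense_bounded_degree\<close>). Together with the assumed bounds on the degrees of larger
  sets, this makes the correlations between edges small, and the independence probability would be at
  most \<open>exp (- q * \<beta> / (16 * s\<^sup>2) * card C)\<close>. Taking \<open>g\<close> to be half of this rate
  gives a contradiction.\<close>

section \<open>Random subsets and Harris's inequality\<close>

definition random_subset_expectation :: "'a set \<Rightarrow> real \<Rightarrow> ('a set \<Rightarrow> real) \<Rightarrow> real" where
  "random_subset_expectation C p f =
    (\<Sum>R\<in>Pow C. p ^ card R * (1 - p) ^ card (C - R) * f R)"

text \<open>The probabilities of all outcomes add up to one when \<open>b = 1 - a\<close>, and the case \<open>b = 1\<close> is the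
  plain generating function of all subsets.\<close>

lemma sum_power_card_Pow:
  fixes a b :: "'a :: comm_semiring_1"
  assumes "finite C"
  shows "(\<Sum>R\<in>Pow C. a ^ card R * b ^ card (C - R)) = (a + b) ^ card C"
  using prod_add[OF assms, of "\<lambda>_. a" "\<lambda>_. b"] by simp

lemma expectation_const:
  assumes "finite C"
  shows "random_subset_expectation C p (\<lambda>_. c) = c"
  using sum_power_card_Pow[OF assms, of p "1 - p"]
  by (simp add: random_subset_expectation_def sum_distrib_right[symmetric])

lemma expectation_mono:
  assumes "0 \<le> p" "p \<le> 1" "\<And>R. R \<subseteq> C \<Longrightarrow> f R \<le> h R"
  shows "random_subset_expectation C p f \<le> random_subset_expectation C p h"
  unfolding random_subset_expectation_def
  by (intro sum_mono mult_left_mono) (use assms in auto)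

lemma expectation_nonneg:
  assumes "0 \<le> p" "p \<le> 1" "\<And>R. R \<subseteq> C \<Longrightarrow> 0 \<le> f R"
  shows "0 \<le> random_subset_expectation C p f"
  unfolding random_subset_expectation_def
  by (intro sum_nonneg mult_nonneg_nonneg) (use assms in auto)

lemma expectation_insert:
  assumes "finite C" "v \<notin> C"
  shows "random_subset_expectation (insert v C) p f =
    (1 - p) * random_subset_expectation C p f +
    p * random_subset_expectation C p (\<lambda>R. f (insert v R))"
proof -
  have inj: "inj_on (insert v) (Pow C)" using assms(2) by (auto simp: inj_on_def)
  have fin: "finite R" "v \<notin> R" if "R \<subseteq> C" for R using that assms finite_subset by auto
  have c1: "card (insert v C - R) = Suc (card (C - R))" if "R \<subseteq> C" for R
    using fin[OF that] assms by (simp add: insert_Diff_if)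
  have c2: "insert v C - insert v R = C - R" if "R \<subseteq> C" for R
    using assms by auto
  have "random_subset_expectation (insert v C) p f =
      (\<Sum>R\<in>Pow C. p ^ card R * (1 - p) ^ card (insert v C - R) * f R) +
      (\<Sum>R\<in>insert v ` Pow C. p ^ card R * (1 - p) ^ card (insert v C - R) * f R)"
    unfolding random_subset_expectation_def Pow_insert
    by (rule sum.union_disjoint) (use assms in auto)
  also have "(\<Sum>R\<in>Pow C. p ^ card R * (1 - p) ^ card (insert v C - R) * f R) =
      (1 - p) * random_subset_expectation C p f"
    unfolding random_subset_expectation_def sum_distrib_left
    by (rule sum.cong) (use c1 in auto)
  also have "(\<Sum>R\<in>insert v ` Pow C. p ^ card R * (1 - p) ^ card (insert v C - R) * f R) =
      p * random_subset_expectation C p (\<lambda>R. f (insert v R))"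
    unfolding random_subset_expectation_def sum_distrib_left sum.reindex[OF inj] o_def
    by (rule sum.cong) (use c2 fin in auto)
  finally show ?thesis .
qed

text \<open>Harris's correlation inequality for decreasing functions, by exposing one element at a time:
  conditioned on that element the inequality holds by induction, and the two conditional expectations
  of \<open>f\<close> are ordered in the same way as those of \<open>h\<close>.\<close>

lemma expectation_Harris:
  assumes "finite C" "0 \<le> p" "p \<le> 1"
    and "\<And>R S. R \<subseteq> S \<Longrightarrow> f S \<le> f R" "\<And>R S. R \<subseteq> S \<Longrightarrow> h S \<le> h R"
  shows "random_subset_expectation C p f * random_subset_expectation C p h \<le>
    random_subset_expectation C p (\<lambda>R. f R * h R)"
  using assms(1,4,5)
proof (induction C arbitrary: f h rule: finite_induct)
  case empty
  then show ?case by (simp add: random_subset_expectation_def)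
next
  case (insert v C)
  let ?E = "random_subset_expectation C p"
  have m: "insert v R \<subseteq> insert v S" if "R \<subseteq> S" for R S :: "'a set" using that by auto
  have 1: "?E f * ?E h \<le> ?E (\<lambda>R. f R * h R)"
    by (rule insert.IH) (use insert.prems in auto)
  have 2: "?E (\<lambda>R. f (insert v R)) * ?E (\<lambda>R. h (insert v R)) \<le>
      ?E (\<lambda>R. f (insert v R) * h (insert v R))"
    by (rule insert.IH) (use insert.prems m in auto)
  have 3: "?E (\<lambda>R. f (insert v R)) \<le> ?E f" "?E (\<lambda>R. h (insert v R)) \<le> ?E h"
    by (auto intro!: expectation_mono insert.prems assms)
  have key: "((1 - p) * a + p * a') * ((1 - p) * b + p * b') \<le> (1 - p) * ab + p * ab'"
    if "a * b \<le> ab" "a' * b' \<le> ab'" "a' \<le> a" "b' \<le> b" for a a' b b' ab ab' :: real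
  proof -
    have "0 \<le> p * (1 - p) * ((a - a') * (b - b'))"
      using that assms by (intro mult_nonneg_nonneg) auto
    also have "\<dots> = (1 - p) * (a * b) + p * (a' * b') -
        ((1 - p) * a + p * a') * ((1 - p) * b + p * b')"
      by (simp add: algebra_simps)
    also have "(1 - p) * (a * b) + p * (a' * b') \<le> (1 - p) * ab + p * ab'"
      using that assms by (intro add_mono mult_left_mono) auto
    finally show ?thesis by simp
  qed
  show ?case
    unfolding expectation_insert[OF insert.hyps] by (rule key) (use 1 2 3 in auto)
qed

text \<open>Conditioned on containing \<open>A\<close>, the random set is distributed as \<open>R \<union> A\<close> for an unconditioned
  random set \<open>R\<close>.\<close>

lemma expectation_superset:
  assumes "finite C" "A \<subseteq> C"
  shows "random_subset_expectation C p (\<lambda>R. of_bool (A \<subseteq> R) * f R) =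
    p ^ card A * random_subset_expectation C p (\<lambda>R. f (R \<union> A))"
  using assms
proof (induction C arbitrary: A f rule: finite_induct)
  case empty
  then show ?case by (simp add: random_subset_expectation_def)
next
  case (insert v C)
  let ?E = "random_subset_expectation C p"
  show ?case
  proof (cases "v \<in> A")
    case True
    define B where "B = A - {v}"
    have A: "A = insert v B" "v \<notin> B" "B \<subseteq> C" using True insert by (auto simp: B_def)
    have card: "card A = Suc (card B)"
      using A insert.hyps(1) finite_subset by fastforce
    have "?E (\<lambda>R. of_bool (A \<subseteq> R) * f R) = ?E (\<lambda>_. 0)"
      unfolding random_subset_expectation_def
      by (rule sum.cong) (use A insert.hyps in auto)
    moreover have "?E (\<lambda>R. of_bool (A \<subseteq> insert v R) * f (insert v R)) =
        ?E (\<lambda>R. of_bool (B \<subseteq> R) * f (insert v R))"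
      unfolding A(1) random_subset_expectation_def
      by (rule sum.cong) (use A in auto)
    moreover have "insert v R \<union> B = R \<union> A" "insert v R \<union> A = R \<union> A" for R using A by auto
    ultimately show ?thesis
      unfolding expectation_insert[OF insert.hyps] card
      using insert.IH[OF A(3), of "\<lambda>R. f (insert v R)"] insert.hyps
      by (simp add: expectation_const algebra_simps)
  next
    case False
    then have A: "A \<subseteq> C" using insert.prems by auto
    have "(A \<subseteq> insert v R) = (A \<subseteq> R)" for R using False by auto
    then show ?thesis
      unfolding expectation_insert[OF insert.hyps]
      using insert.IH[OF A, of f] insert.IH[OF A, of "\<lambda>R. f (insert v R)"]
      by (simp add: algebra_simps)
  qed
qed

section \<open>Janson's inequality\<close>

text \<open>For \<open>l = 1\<close> this is the indicator of the event that \<open>R\<close> contains no edge. A factor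
  \<open>l < 1\<close> plays the role of keeping each edge with probability \<open>l\<close>, which turns the bound
  \<open>exp (- \<mu> + \<Delta>)\<close> obtained for \<open>l = 1\<close> into \<open>exp (- l * \<mu> + l\<^sup>2 * \<Delta>)\<close>. The latter is
  useful even when \<open>\<Delta>\<close> is much larger than \<open>\<mu>\<close>.\<close>

definition damped_avoidance :: "real \<Rightarrow> 'a set multiset \<Rightarrow> 'a set \<Rightarrow> real" where
  "damped_avoidance l M R = (\<Prod>A\<in>#M. 1 - l * of_bool (A \<subseteq> R))"

lemma damped_avoidance_add_mset:
  "damped_avoidance l (add_mset A M) R = (1 - l * of_bool (A \<subseteq> R)) * damped_avoidance l M R"
  by (simp add: damped_avoidance_def)

lemma damped_avoidance_bounds:
  assumes "0 \<le> l" "l \<le> 1"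
  shows "0 \<le> damped_avoidance l M R" "damped_avoidance l M R \<le> 1"
proof -
  have "0 \<le> damped_avoidance l M R \<and> damped_avoidance l M R \<le> 1"
    using assms by (induction M) (auto simp: damped_avoidance_def intro!: mult_le_one)
  then show "0 \<le> damped_avoidance l M R" "damped_avoidance l M R \<le> 1" by auto
qed

lemma damped_avoidance_antimono:
  assumes "0 \<le> l" "l \<le> 1" "R \<subseteq> S"
  shows "damped_avoidance l M S \<le> damped_avoidance l M R"
proof (induction M)
  case empty
  then show ?case by (simp add: damped_avoidance_def)
next
  case (add A M)
  show ?case
    unfolding damped_avoidance_add_mset
    by (rule mult_mono) (use assms add damped_avoidance_bounds[OF assms(1,2)] in auto)
qed

lemma damped_avoidance_ge:
  assumes "0 \<le> l" "l \<le> 1"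
  shows "1 - l * (\<Sum>A\<in>#M. of_bool (A \<subseteq> R)) \<le> damped_avoidance l M R"
proof (induction M)
  case empty
  then show ?case by (simp add: damped_avoidance_def)
next
  case (add A M)
  then show ?case
    using damped_avoidance_bounds[OF assms, of M R] assms mult_left_mono[of "damped_avoidance l M R" 1 l]
    by (auto simp: damped_avoidance_add_mset algebra_simps)
qed

lemma expectation_linear_sum_mset:
  "random_subset_expectation C p (\<lambda>R. \<Sum>A\<in>#M. f A R) =
    (\<Sum>A\<in>#M. random_subset_expectation C p (f A))"
  by (induction M) (simp_all add: random_subset_expectation_def distrib_left sum.distrib)

lemma expectation_diff_cmult:
  "random_subset_expectation C p (\<lambda>R. f R - c * h R) =
    random_subset_expectation C p f - c * random_subset_expectation C p h"
  by (simp add: random_subset_expectation_def sum_subtractf sum_distrib_left algebra_simps)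

lemma probability_superset:
  assumes "finite C" "A \<subseteq> C"
  shows "random_subset_expectation C p (\<lambda>R. of_bool (A \<subseteq> R)) = p ^ card A"
  using expectation_superset[OF assms, of p "\<lambda>_. 1"] assms(1) by (simp add: expectation_const)

text \<open>Conditioning on \<open>A \<subseteq> R\<close> affects only the edges that meet \<open>A\<close>. Harris's inequality separates
  them from the other edges, and their own contribution is bounded below linearly.\<close>

lemma damped_avoidance_link:
  assumes "finite C" "0 \<le> p" "p \<le> 1" "0 \<le> l" "l \<le> 1"
    and "\<And>B. B \<in># M \<Longrightarrow> B \<subseteq> C"
  shows "(1 - l * (\<Sum>B\<in>#{#B \<in># M. B \<inter> A \<noteq> {}#}. p ^ card (B - A))) *
      random_subset_expectation C p (damped_avoidance l M) \<le>
    random_subset_expectation C p (\<lambda>R. damped_avoidance l M (R \<union> A))"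
proof -
  let ?E = "random_subset_expectation C p"
  let ?N = "{#B \<in># M. B \<inter> A \<noteq> {}#}"
  let ?N' = "{#B \<in># M. \<not> B \<inter> A \<noteq> {}#}"
  let ?f = "\<lambda>R. damped_avoidance l ?N (R \<union> A)"
  have split: "damped_avoidance l M R = damped_avoidance l ?N R * damped_avoidance l ?N' R" for R
    unfolding damped_avoidance_def
    by (subst multiset_partition[of M "\<lambda>B. B \<inter> A \<noteq> {}"], subst image_mset_union) simp
  have disj: "damped_avoidance l ?N' (R \<union> A) = damped_avoidance l ?N' R" for R
    unfolding damped_avoidance_def
  proof (intro arg_cong[of _ _ prod_mset] image_mset_cong)
    fix B assume "B \<in># ?N'"
    then have "B \<subseteq> R \<union> A \<longleftrightarrow> B \<subseteq> R" by auto
    then show "1 - l * of_bool (B \<subseteq> R \<union> A) = 1 - l * of_bool (B \<subseteq> R)" by simp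
  qed
  have "?E ?f * ?E (damped_avoidance l ?N') \<le> ?E (\<lambda>R. ?f R * damped_avoidance l ?N' R)"
    by (rule expectation_Harris) (use assms in \<open>auto intro!: damped_avoidance_antimono\<close>)
  also have "\<dots> = ?E (\<lambda>R. damped_avoidance l M (R \<union> A))"
    using disj by (simp add: split[of "_ \<union> A"])
  finally have harris: "?E ?f * ?E (damped_avoidance l ?N') \<le>
      ?E (\<lambda>R. damped_avoidance l M (R \<union> A))" .
  have nonneg: "0 \<le> ?E (damped_avoidance l M)" "0 \<le> ?E ?f"
    by (rule expectation_nonneg[OF assms(2,3)], rule damped_avoidance_bounds(1)[OF assms(4,5)])+
  have "1 - l * (\<Sum>B\<in>#?N. p ^ card (B - A)) =
      ?E (\<lambda>R. 1 - l * (\<Sum>B\<in>#?N. of_bool (B - A \<subseteq> R)))"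
  proof -
    have "(\<Sum>B\<in>#?N. p ^ card (B - A)) = (\<Sum>B\<in>#?N. ?E (\<lambda>R. of_bool (B - A \<subseteq> R)))"
      by (intro arg_cong[of _ _ sum_mset] image_mset_cong probability_superset[symmetric])
        (use assms in auto)
    then show ?thesis
      using assms(1) by (simp only: expectation_diff_cmult expectation_linear_sum_mset expectation_const)
  qed
  also have "\<dots> \<le> ?E ?f"
  proof (rule expectation_mono[OF assms(2,3)])
    fix R
    have "(B - A \<subseteq> R) = (B \<subseteq> R \<union> A)" for B by auto
    then show "1 - l * (\<Sum>B\<in>#?N. of_bool (B - A \<subseteq> R)) \<le> ?f R"
      using damped_avoidance_ge[OF assms(4,5), where M = ?N and R = "R \<union> A"] by simp
  qed
  finally have "(1 - l * (\<Sum>B\<in>#?N. p ^ card (B - A))) * ?E (damped_avoidance l M) \<le>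
      ?E ?f * ?E (damped_avoidance l M)"
    using nonneg by (intro mult_right_mono)
  also have "\<dots> \<le> ?E ?f * ?E (damped_avoidance l ?N')"
  proof (intro mult_left_mono expectation_mono[OF assms(2,3)] nonneg)
    fix R
    show "damped_avoidance l M R \<le> damped_avoidance l ?N' R"
      unfolding split
      using damped_avoidance_bounds[OF assms(4,5)] by (intro mult_left_le_one_le) auto
  qed
  finally show ?thesis using harris by linarith
qed

text \<open>Each new edge \<open>A\<close> multiplies the expectation by at most \<open>1 - l * p ^ card A * (1 - l * L)\<close>, where
  \<open>L\<close> bounds the expected number of edges in the random set that meet \<open>A\<close>, given that \<open>A\<close> is
  there.\<close>

lemma expectation_damped_avoidance_le:
  assumes "finite C" "0 \<le> p" "p \<le> 1" "0 \<le> l" "l \<le> 1"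
    and "\<And>A. A \<in># M \<Longrightarrow> A \<subseteq> C"
    and "\<And>A. A \<in># M \<Longrightarrow> (\<Sum>B\<in>#{#B \<in># M. B \<inter> A \<noteq> {}#}. p ^ card (B - A)) \<le> L"
  shows "random_subset_expectation C p (damped_avoidance l M) \<le>
    exp (- (l - l\<^sup>2 * L) * (\<Sum>A\<in>#M. p ^ card A))"
  using assms(6,7)
proof (induction M)
  case empty
  then show ?case using assms(1) by (simp add: damped_avoidance_def expectation_const)
next
  case (add A M)
  let ?E = "random_subset_expectation C p"
  let ?E1 = "?E (damped_avoidance l M)"
  have sum_le: "(\<Sum>B\<in>#{#B \<in># M. B \<inter> A' \<noteq> {}#}. p ^ card (B - A')) \<le> L" if "A' \<in># add_mset A M" for A'
    using add.prems(2)[OF that] assms(2) by (auto split: if_splits intro: order_trans[rotated])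
  have IH: "?E1 \<le> exp (- (l - l\<^sup>2 * L) * (\<Sum>A\<in>#M. p ^ card A))"
    by (rule add.IH) (use add.prems(1) sum_le in auto)
  have nonneg: "0 \<le> ?E1"
    by (rule expectation_nonneg[OF assms(2,3)], rule damped_avoidance_bounds(1)[OF assms(4,5)])
  have "(1 - l * L) * ?E1 \<le> (1 - l * (\<Sum>B\<in>#{#B \<in># M. B \<inter> A \<noteq> {}#}. p ^ card (B - A))) * ?E1"
    using sum_le[of A] nonneg assms(4) by (intro mult_right_mono) (auto intro: mult_left_mono)
  also have "\<dots> \<le> ?E (\<lambda>R. damped_avoidance l M (R \<union> A))"
    by (rule damped_avoidance_link) (use assms add.prems in auto)
  finally have link: "(1 - l * L) * ?E1 \<le> ?E (\<lambda>R. damped_avoidance l M (R \<union> A))" .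
  have "?E (damped_avoidance l (add_mset A M)) =
      ?E (\<lambda>R. damped_avoidance l M R - l * (of_bool (A \<subseteq> R) * damped_avoidance l M R))"
    by (simp add: damped_avoidance_add_mset[abs_def] algebra_simps)
  also have "\<dots> = ?E1 - l * (p ^ card A * ?E (\<lambda>R. damped_avoidance l M (R \<union> A)))"
    using add.prems assms(1)
    by (simp only: expectation_diff_cmult expectation_superset union_single_eq_member)
  also have "\<dots> \<le> ?E1 - l * (p ^ card A * ((1 - l * L) * ?E1))"
    using link assms by (intro diff_left_mono mult_left_mono) auto
  also have "\<dots> = ?E1 * (1 + - (l - l\<^sup>2 * L) * p ^ card A)"
    by (simp add: algebra_simps power2_eq_square)
  also have "\<dots> \<le> ?E1 * exp (- (l - l\<^sup>2 * L) * p ^ card A)"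
    using nonneg by (intro mult_left_mono exp_ge_add_one_self)
  also have "\<dots> \<le> exp (- (l - l\<^sup>2 * L) * (\<Sum>A\<in>#M. p ^ card A)) * exp (- (l - l\<^sup>2 * L) * p ^ card A)"
    using IH by (intro mult_right_mono) auto
  also have "\<dots> = exp (- (l - l\<^sup>2 * L) * (\<Sum>A\<in>#add_mset A M. p ^ card A))"
    by (simp add: exp_add[symmetric] algebra_simps)
  finally show ?case .
qed

text \<open>Janson's inequality up to a constant: with \<open>\<mu>\<close> the expected number of edges in the random set
  and \<open>\<Delta>\<close> the sum of \<open>p ^ card (A \<union> B)\<close> over intersecting pairs, the hypothesis implies
  \<open>\<Delta> \<le> \<mu> * L\<close>, and \<open>\<mu> / L\<close> takes the place of \<open>\<mu>\<^sup>2 / \<Delta>\<close> in the exponent.\<close>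

lemma Janson_inequality:
  assumes "finite C" "0 \<le> p" "p \<le> 1" "1 / 2 \<le> L"
    and "\<And>A. A \<in># M \<Longrightarrow> A \<subseteq> C"
    and "\<And>A. A \<in># M \<Longrightarrow> (\<Sum>B\<in>#{#B \<in># M. B \<inter> A \<noteq> {}#}. p ^ card (B - A)) \<le> L"
  shows "random_subset_expectation C p (\<lambda>R. of_bool (\<forall>A\<in>#M. \<not> A \<subseteq> R)) \<le>
    exp (- (\<Sum>A\<in>#M. p ^ card A) / (4 * L))"
proof -
  \<comment> \<open>This value maximises \<open>l - l\<^sup>2 * L\<close>.\<close>
  define l where "l = 1 / (2 * L)"
  have l: "0 \<le> l" "l \<le> 1" using assms(4) by (auto simp: l_def field_simps)
  have "random_subset_expectation C p (\<lambda>R. of_bool (\<forall>A\<in>#M. \<not> A \<subseteq> R)) \<le>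
      random_subset_expectation C p (damped_avoidance l M)"
  proof (rule expectation_mono[OF assms(2,3)])
    fix R
    show "of_bool (\<forall>A\<in>#M. \<not> A \<subseteq> R) \<le> damped_avoidance l M R"
    proof (cases "\<forall>A\<in>#M. \<not> A \<subseteq> R")
      case True
      then have "damped_avoidance l M R = 1"
        by (induction M) (auto simp: damped_avoidance_def)
      then show ?thesis by simp
    qed (use damped_avoidance_bounds[OF l] in auto)
  qed
  also have "\<dots> \<le> exp (- (l - l\<^sup>2 * L) * (\<Sum>A\<in>#M. p ^ card A))"
    by (rule expectation_damped_avoidance_le) (use assms l in auto)
  also have "l - l\<^sup>2 * L = 1 / (4 * L)"
    using assms(4) by (simp add: l_def power2_eq_square field_simps)
  finally show ?thesis by simp
qed


section \<open>The partition function and its potential\<close>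

text \<open>The partition function at activity \<open>x\<close> of the hard-core model on those subsets of \<open>C\<close> that
  remain in \<open>F\<close> after \<open>T\<close> is added.\<close>

definition partition_fun :: "'a set set \<Rightarrow> 'a set \<Rightarrow> 'a set \<Rightarrow> real \<Rightarrow> real" where
  "partition_fun F C T x = (\<Sum>R | R \<subseteq> C \<and> R \<union> T \<in> F. x ^ card R)"

text \<open>The substitution \<open>x = exp t - 1\<close> makes activity \<open>x\<close> correspond to the inclusion probability
  \<open>1 - exp (- t)\<close>. The partition function of all subsets of \<open>C\<close> becomes
  \<open>exp (t * card C)\<close>, and the logarithmic derivative in \<open>t\<close> takes the simple form used below.\<close>

definition potential :: "'a set set \<Rightarrow> 'a set \<Rightarrow> 'a set \<Rightarrow> real \<Rightarrow> real" where
  "potential F C T u = integral {0..u} (\<lambda>t. ln (partition_fun F C T (exp t - 1)))"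

lemma partition_fun_mono:
  assumes "finite C'" "C \<subseteq> C'" "0 \<le> x" "\<And>R. R \<subseteq> C \<Longrightarrow> R \<union> T \<in> F \<Longrightarrow> R \<union> T' \<in> F"
  shows "partition_fun F C T x \<le> partition_fun F C' T' x"
  unfolding partition_fun_def
proof (rule sum_mono2)
  show "finite {R. R \<subseteq> C' \<and> R \<union> T' \<in> F}"
    using assms(1) by (rule finite_subset[rotated, OF iffD2[OF finite_Pow_iff]]) auto
qed (use assms in auto)

lemma partition_fun_ge_1:
  assumes "finite C" "T \<in> F" "0 \<le> x"
  shows "1 \<le> partition_fun F C T x"
proof -
  have "partition_fun F {} T x = 1"
    using assms by (simp add: partition_fun_def conj_commute cong: conj_cong)
  then show ?thesis
    using partition_fun_mono[of C "{}" x T F T] assms by simp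
qed

lemma partition_fun_le:
  assumes "finite C" "0 \<le> x"
  shows "partition_fun F C T x \<le> (1 + x) ^ card C"
proof -
  have "partition_fun F C T x \<le> (\<Sum>R\<in>Pow C. x ^ card R)"
    unfolding partition_fun_def by (rule sum_mono2) (use assms in auto)
  also have "\<dots> = (1 + x) ^ card C"
    using sum_power_card_Pow[OF assms(1), of x 1] by (simp add: add.commute)
  finally show ?thesis .
qed

text \<open>The sets counted on the left come in pairs \<open>R\<close>, \<open>R - {v}\<close> with \<open>v \<in> R\<close>, because membership in
  \<open>F\<close> after adding \<open>insert v T\<close> does not depend on whether \<open>v \<in> R\<close>.\<close>

lemma partition_fun_insert:
  assumes "finite C" "v \<in> C"
  shows "partition_fun F C (insert v T) x =
    (1 + x) * (\<Sum>R | R \<subseteq> C \<and> R \<union> T \<in> F \<and> v \<in> R. x ^ (card R - 1))"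
proof -
  let ?A = "{R. R \<subseteq> C \<and> R \<union> T \<in> F \<and> v \<in> R}"
  let ?B = "(\<lambda>R. R - {v}) ` ?A"
  have fin: "finite ?A"
    using assms(1) by (rule finite_subset[rotated, OF iffD2[OF finite_Pow_iff]]) auto
  have inj: "inj_on (\<lambda>R. R - {v}) ?A"
    by (rule inj_onI) blast
  have eq: "{R. R \<subseteq> C \<and> R \<union> insert v T \<in> F} = ?A \<union> ?B"
  proof (intro equalityI subsetI)
    fix R assume R: "R \<in> {R. R \<subseteq> C \<and> R \<union> insert v T \<in> F}"
    show "R \<in> ?A \<union> ?B"
    proof (cases "v \<in> R")
      case True
      then show ?thesis using R by (auto simp: insert_absorb)
    next
      case False
      then have "R = insert v R - {v}" "insert v R \<in> ?A" using R assms(2) by auto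
      then show ?thesis by blast
    qed
  next
    fix R assume "R \<in> ?A \<union> ?B"
    then show "R \<in> {R. R \<subseteq> C \<and> R \<union> insert v T \<in> F}"
    proof
      assume R: "R \<in> ?A"
      then have "R \<union> insert v T = R \<union> T" by auto
      with R show ?thesis by auto
    next
      assume "R \<in> ?B"
      then obtain Q where Q: "Q \<in> ?A" "R = Q - {v}" by blast
      then have "R \<union> insert v T = Q \<union> T" by auto
      with Q show ?thesis by auto
    qed
  qed
  have pw: "x ^ card R = x * x ^ (card R - 1)" if "R \<in> ?A" for R
  proof -
    have "finite R" using that assms(1) finite_subset by auto
    then have "card R > 0" using that card_gt_0_iff by blast
    then show ?thesis by (simp add: power_eq_if)
  qed
  have "partition_fun F C (insert v T) x = (\<Sum>R\<in>?A. x ^ card R) + (\<Sum>R\<in>?B. x ^ card R)"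
    unfolding partition_fun_def eq by (rule sum.union_disjoint) (use fin in auto)
  also have "(\<Sum>R\<in>?B. x ^ card R) = (\<Sum>R\<in>?A. x ^ (card R - 1))"
    by (subst sum.reindex[OF inj]) (auto intro!: sum.cong simp: card_Diff_singleton)
  also have "(\<Sum>R\<in>?A. x ^ card R) = (\<Sum>R\<in>?A. x * x ^ (card R - 1))"
    by (rule sum.cong) (use pw in auto)
  finally show ?thesis unfolding sum_distrib_left[symmetric] by (simp add: algebra_simps)
qed

text \<open>The sum on the right is the derivative of the partition function in \<open>x\<close>. This identity, a form
  of Russo's formula, ties that derivative to the effect of adding single vertices to \<open>T\<close>.\<close>

lemma sum_partition_fun_insert:
  assumes "finite C"
  shows "(\<Sum>v\<in>C. partition_fun F C (insert v T) x) =
    (1 + x) * (\<Sum>R | R \<subseteq> C \<and> R \<union> T \<in> F. real (card R) * x ^ (card R - 1))"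
proof -
  let ?F = "{R. R \<subseteq> C \<and> R \<union> T \<in> F}"
  have fin: "finite ?F"
    using assms(1) by (rule finite_subset[rotated, OF iffD2[OF finite_Pow_iff]]) auto
  have "(\<Sum>v\<in>C. partition_fun F C (insert v T) x) =
      (1 + x) * (\<Sum>v\<in>C. \<Sum>R | R \<in> ?F \<and> v \<in> R. x ^ (card R - 1))"
    using partition_fun_insert[OF assms] by (simp add: sum_distrib_left conj_assoc)
  also have "(\<Sum>v\<in>C. \<Sum>R | R \<in> ?F \<and> v \<in> R. x ^ (card R - 1)) =
      (\<Sum>R\<in>?F. \<Sum>v | v \<in> C \<and> v \<in> R. x ^ (card R - 1))"
    by (rule sum.swap_restrict) (use assms fin in auto)
  also have "\<dots> = (\<Sum>R\<in>?F. real (card R) * x ^ (card R - 1))"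
  proof (rule sum.cong)
    fix R assume "R \<in> ?F"
    then have "{v. v \<in> C \<and> v \<in> R} = R" by auto
    then show "(\<Sum>v | v \<in> C \<and> v \<in> R. x ^ (card R - 1)) = real (card R) * x ^ (card R - 1)" by simp
  qed simp
  finally show ?thesis .
qed

lemma has_real_derivative_partition_fun:
  "(partition_fun F C T has_real_derivative
    (\<Sum>R | R \<subseteq> C \<and> R \<union> T \<in> F. real (card R) * x ^ (card R - 1))) (at x)"
  unfolding partition_fun_def
  by (rule DERIV_sum) (rule derivative_eq_intros refl | simp)+

lemma has_real_derivative_ln_partition_fun:
  assumes "finite C" "T \<in> F" "0 \<le> t"
  shows "((\<lambda>t. ln (partition_fun F C T (exp t - 1))) has_real_derivative
    (\<Sum>v\<in>C. partition_fun F C (insert v T) (exp t - 1) / partition_fun F C T (exp t - 1))) (at t)"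
proof -
  let ?x = "exp t - 1"
  let ?D = "\<Sum>R | R \<subseteq> C \<and> R \<union> T \<in> F. real (card R) * ?x ^ (card R - 1)"
  have pos: "0 < partition_fun F C T ?x"
    using partition_fun_ge_1[OF assms(1,2), of ?x] assms(3) by simp
  have d: "((\<lambda>t. partition_fun F C T (exp t - 1)) has_real_derivative ?D * exp t) (at t)"
    by (rule DERIV_chain2[OF has_real_derivative_partition_fun]) (auto intro!: derivative_eq_intros)
  have "((\<lambda>t. ln (partition_fun F C T (exp t - 1))) has_real_derivative
      1 / partition_fun F C T ?x * (?D * exp t)) (at t)"
    by (rule DERIV_chain2[OF _ d]) (use pos in \<open>auto intro!: derivative_eq_intros\<close>)
  also have "1 / partition_fun F C T ?x * (?D * exp t) =
      (\<Sum>v\<in>C. partition_fun F C (insert v T) ?x / partition_fun F C T ?x)"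
    using sum_partition_fun_insert[OF assms(1), of F T ?x]
    by (simp add: sum_divide_distrib[symmetric] mult.commute)
  finally show ?thesis .
qed

lemma continuous_on_ln_partition_fun:
  assumes "finite C" "T \<in> F"
  shows "continuous_on {0..u} (\<lambda>t. ln (partition_fun F C T (exp t - 1)))"
  by (rule DERIV_continuous_on, rule has_field_derivative_at_within,
      rule has_real_derivative_ln_partition_fun) (use assms in auto)

lemma integrable_ln_partition_fun:
  assumes "finite C" "T \<in> F"
  shows "(\<lambda>t. ln (partition_fun F C T (exp t - 1))) integrable_on {0..u}"
  by (rule integrable_continuous_real[OF continuous_on_ln_partition_fun[OF assms]])

lemma potential_nonneg:
  assumes "finite C" "T \<in> F"
  shows "0 \<le> potential F C T u"
  unfolding potential_def
  by (rule integral_nonneg[OF integrable_ln_partition_fun[OF assms]])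
    (use partition_fun_ge_1[OF assms] in auto)

lemma potential_mono:
  assumes "finite C'" "C \<subseteq> C'" "T \<in> F"
  shows "potential F C T u \<le> potential F C' T u"
proof -
  have fin: "finite C" using assms finite_subset by auto
  show ?thesis
    unfolding potential_def
  proof (rule integral_le[OF integrable_ln_partition_fun[OF fin assms(3)]
        integrable_ln_partition_fun[OF assms(1,3)]])
    fix t assume "t \<in> {0..u}"
    then have x: "0 \<le> exp t - 1" by simp
    show "ln (partition_fun F C T (exp t - 1)) \<le> ln (partition_fun F C' T (exp t - 1))"
      using partition_fun_ge_1[OF fin assms(3) x] partition_fun_mono[OF assms(1,2) x, of T F T]
      by (simp add: ln_mono)
  qed
qed

lemma potential_le:
  assumes "finite C" "T \<in> F" "0 \<le> u"
  shows "potential F C T u \<le> real (card C) * u\<^sup>2"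
proof -
  have "potential F C T u \<le> integral {0..u} (\<lambda>t. real (card C) * u)"
    unfolding potential_def
  proof (rule integral_le[OF integrable_ln_partition_fun[OF assms(1,2)]])
    fix t assume t: "t \<in> {0..u}"
    then have x: "0 \<le> exp t - 1" by simp
    have "ln (partition_fun F C T (exp t - 1)) \<le> ln ((1 + (exp t - 1)) ^ card C)"
      using partition_fun_ge_1[OF assms(1,2) x] partition_fun_le[OF assms(1) x, of F T]
      by (intro ln_mono) auto
    also have "\<dots> = real (card C) * t" by (simp add: ln_realpow)
    also have "\<dots> \<le> real (card C) * u" using t by (simp add: mult_left_mono)
    finally show "ln (partition_fun F C T (exp t - 1)) \<le> real (card C) * u" .
  qed auto
  then show ?thesis using assms(3) by (simp add: power2_eq_square)
qed

text \<open>By \<open>1 - y \<le> - ln y\<close>, the sum over \<open>v\<close> of the drops of \<open>ln Z\<close> at \<open>t\<close> is at least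
  \<open>card C\<close> minus the derivative of \<open>ln Z\<close> at \<open>t\<close>. Integrating over \<open>t\<close> gives the left-hand side, which is
  minus the logarithm of the probability that the random set with inclusion probability
  \<open>1 - exp (- u)\<close> remains in \<open>F\<close> after \<open>T\<close> is added.\<close>

lemma sum_potential_drop:
  fixes C :: "'a set"
  assumes "finite C" "T \<in> F" "\<And>v. v \<in> C \<Longrightarrow> insert v T \<in> F" "0 \<le> u"
  shows "real (card C) * u - ln (partition_fun F C T (exp u - 1)) \<le>
    (\<Sum>v\<in>C. potential F C T u - potential F C (insert v T) u)"
proof -
  let ?Z = "\<lambda>t. partition_fun F C T (exp t - 1)"
  let ?Zv = "\<lambda>v t. partition_fun F C (insert v T) (exp t - 1)"
  have "((\<lambda>t. \<Sum>v\<in>C. ?Zv v t / ?Z t) has_integral ln (?Z u) - ln (?Z 0)) {0..u}"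
  proof (rule fundamental_theorem_of_calculus[OF assms(4)])
    fix t assume t: "t \<in> {0..u}"
    show "((\<lambda>t. ln (?Z t)) has_vector_derivative (\<Sum>v\<in>C. ?Zv v t / ?Z t)) (at t within {0..u})"
      unfolding has_real_derivative_iff_has_vector_derivative[symmetric]
      by (rule has_field_derivative_at_within, rule has_real_derivative_ln_partition_fun)
        (use assms(1,2) t in auto)
  qed
  moreover have "?Z 0 = 1"
  proof -
    have fin: "finite {R. R \<subseteq> C \<and> R \<union> T \<in> F}"
      using assms(1) by (rule finite_subset[rotated, OF iffD2[OF finite_Pow_iff]]) auto
    have "?Z 0 = (\<Sum>R\<in>{{} :: 'a set}. 1)"
      unfolding partition_fun_def
      \<comment> \<open>At activity 0 only the empty set contributes, as \<open>0 ^ 0 = 1\<close>.\<close>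
    proof (rule sum.mono_neutral_cong_right[OF fin])
      show "\<forall>R\<in>{R. R \<subseteq> C \<and> R \<union> T \<in> F} - {{}}. (exp 0 - 1 :: real) ^ card R = 0"
      proof
        fix R assume "R \<in> {R. R \<subseteq> C \<and> R \<union> T \<in> F} - {{}}"
        then have "finite R" "R \<noteq> {}" using finite_subset[OF _ assms(1)] by auto
        then have "card R \<noteq> 0" by simp
        then show "(exp 0 - 1 :: real) ^ card R = 0" by simp
      qed
    qed (use assms(2) in auto)
    then show ?thesis by simp
  qed
  ultimately have int1: "((\<lambda>t. \<Sum>v\<in>C. ?Zv v t / ?Z t) has_integral ln (?Z u)) {0..u}" by simp
  have int2: "((\<lambda>t. \<Sum>v\<in>C. 1 - ?Zv v t / ?Z t) has_integral real (card C) * u - ln (?Z u)) {0..u}"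
    using has_integral_diff[OF has_integral_const_real[of "real (card C)" 0 u] int1] assms(4)
    by (simp add: sum_subtractf mult.commute)
  have int3: "((\<lambda>t. \<Sum>v\<in>C. ln (?Z t) - ln (?Zv v t)) has_integral
      (\<Sum>v\<in>C. potential F C T u - potential F C (insert v T) u)) {0..u}"
    unfolding potential_def
  proof (rule has_integral_sum[OF assms(1)])
    fix v assume "v \<in> C"
    then show "((\<lambda>t. ln (?Z t) - ln (?Zv v t)) has_integral
        (integral {0..u} (\<lambda>t. ln (?Z t)) - integral {0..u} (\<lambda>t. ln (?Zv v t)))) {0..u}"
      by (intro has_integral_diff integrable_integral integrable_ln_partition_fun assms(1-3))
  qed
  show ?thesis
  proof (rule has_integral_le[OF int2 int3])
    fix t assume "t \<in> {0..u}"
    then have x: "0 \<le> exp t - 1" by simp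
    show "(\<Sum>v\<in>C. 1 - ?Zv v t / ?Z t) \<le> (\<Sum>v\<in>C. ln (?Z t) - ln (?Zv v t))"
    proof (rule sum_mono)
      fix v assume v: "v \<in> C"
      have "?Z t > 0" "?Zv v t > 0"
        using partition_fun_ge_1[OF assms(1,2) x] partition_fun_ge_1[OF assms(1) assms(3)[OF v] x] by auto
      then show "1 - ?Zv v t / ?Z t \<le> ln (?Z t) - ln (?Zv v t)"
        using ln_le_minus_one[of "?Zv v t / ?Z t"] by (simp add: ln_div)
    qed
  qed
qed

section \<open>Covering a down-closed family by containers\<close>

text \<open>The containers are the leaves of a binary tree of questions \<open>v \<in> I\<close>. A negative answer
  removes one of the \<open>card (C - T)\<close> undecided vertices; a positive answer does so as well and in
  addition lowers the potential by \<open>g\<close>. The bound is a weighted count of the leaves: if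
  \<open>n\<close> vertices stay undecided after the answer and \<open>b = w powr (potential F C T u / g)\<close>, then the two
  branches have at most \<open>b * (1 + 1 / w) ^ n\<close> and \<open>b / w * (1 + 1 / w) ^ n\<close> leaves, which
  add up to \<open>b * (1 + 1 / w) ^ (n + 1)\<close>. Chosen vertices stay in \<open>C\<close>, so a leaf contains all of \<open>I\<close>.

  A vertex with \<open>insert v T \<notin> F\<close> belongs to no \<open>I\<close> under consideration; asking about it leads
  to a negative answer only.\<close>

lemma containers_above:
  assumes down: "\<forall>A\<in>F. Pow A \<subseteq> F"
    and "finite C" "T \<in> F" "T \<subseteq> C" "0 < g" "0 \<le> u" "1 \<le> w"
  shows "\<exists>\<C>. \<C> \<subseteq> Pow C \<and>
    real (card \<C>) \<le> w powr (potential F C T u / g) * (1 + 1 / w) ^ card (C - T) \<and>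
    (\<forall>I\<in>F. T \<subseteq> I \<and> I \<subseteq> C \<longrightarrow> (\<exists>D\<in>\<C>. I \<subseteq> D)) \<and>
    (\<forall>D\<in>\<C>. exp ((u - g) * real (card D)) \<le> partition_fun F D {} (exp u - 1))"
  using assms(2-4)
proof (induction "card (C - T)" arbitrary: C T rule: less_induct)
  case less
  note fin = \<open>finite C\<close> and T = \<open>T \<in> F\<close> \<open>T \<subseteq> C\<close>
  have x: "0 \<le> exp u - 1" using \<open>0 \<le> u\<close> by simp
  have Z1: "1 \<le> partition_fun F C T (exp u - 1)" by (rule partition_fun_ge_1[OF fin T(1) x])
  show ?case
  proof (cases "(u - g) * real (card C) \<le> ln (partition_fun F C T (exp u - 1))")
    case True
    then have "exp ((u - g) * real (card C)) \<le> partition_fun F C T (exp u - 1)"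
      using Z1 by (simp add: ln_ge_iff)
    also have "\<dots> \<le> partition_fun F C {} (exp u - 1)"
      by (rule partition_fun_mono[OF fin subset_refl x]) (drule bspec[OF down], auto)
    finally have "exp ((u - g) * real (card C)) \<le> partition_fun F C {} (exp u - 1)" .
    moreover have "1 * 1 \<le> w powr (potential F C T u / g) * (1 + 1 / w) ^ card (C - T)"
      using potential_nonneg[OF fin T(1)] \<open>1 \<le> w\<close> \<open>0 < g\<close>
      by (intro mult_mono ge_one_powr_ge_zero one_le_power) auto
    ultimately show ?thesis by (intro exI[of _ "{C}"]) auto
  next
    case False
    have "\<exists>v\<in>C. insert v T \<in> F \<longrightarrow> potential F C (insert v T) u \<le> potential F C T u - g"
    proof (rule ccontr)
      assume "\<not> ?thesis"
      then have "insert v T \<in> F \<and> potential F C T u - g < potential F C (insert v T) u"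
        if "v \<in> C" for v using that by (simp add: not_le)
      then have *: "insert v T \<in> F" "potential F C T u - potential F C (insert v T) u \<le> g"
        if "v \<in> C" for v using that by (simp_all add: less_imp_le algebra_simps)
      have "real (card C) * u - ln (partition_fun F C T (exp u - 1)) \<le>
          (\<Sum>v\<in>C. potential F C T u - potential F C (insert v T) u)"
        by (rule sum_potential_drop[OF fin T(1) *(1) \<open>0 \<le> u\<close>])
      also have "\<dots> \<le> (\<Sum>v\<in>C. g)" by (rule sum_mono) (rule *)
      finally show False using False by (simp add: algebra_simps)
    qed
    then obtain v where v: "v \<in> C"
      "insert v T \<in> F \<Longrightarrow> potential F C (insert v T) u \<le> potential F C T u - g" by blast
    have vT: "v \<notin> T"
    proof
      assume "v \<in> T"
      then have "insert v T = T" by auto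
      then show False using v(2) T(1) \<open>0 < g\<close> by simp
    qed
    define n where "n = card (C - insert v T)"
    have "C - T - {v} = C - insert v T" by auto
    then have n: "card (C - T) = Suc n"
      using card_Suc_Diff1[of "C - T" v] fin v(1) vT unfolding n_def by auto
    have "C - {v} - T = C - insert v T" by auto
    then have n': "card (C - {v} - T) = n" by (simp add: n_def)
    let ?b = "w powr (potential F C T u / g)"
    have TC: "T \<subseteq> C - {v}" using T(2) vT by auto
    obtain \<C>1 where C1: "\<C>1 \<subseteq> Pow (C - {v})"
      "real (card \<C>1) \<le> w powr (potential F (C - {v}) T u / g) * (1 + 1 / w) ^ n"
      "\<forall>I\<in>F. T \<subseteq> I \<and> I \<subseteq> C - {v} \<longrightarrow> (\<exists>D\<in>\<C>1. I \<subseteq> D)"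
      "\<forall>D\<in>\<C>1. exp ((u - g) * real (card D)) \<le> partition_fun F D {} (exp u - 1)"
      using less.hyps[OF _ _ T(1) TC, unfolded n' n, OF lessI finite_Diff[OF fin]]
      by (elim exE conjE) (rule that)
    have "w powr (potential F (C - {v}) T u / g) \<le> ?b"
      using potential_mono[OF fin, of "C - {v}" T F u] T \<open>0 < g\<close> \<open>1 \<le> w\<close>
      by (intro powr_mono divide_right_mono) auto
    then have card1: "real (card \<C>1) \<le> ?b * (1 + 1 / w) ^ n"
      using \<open>1 \<le> w\<close> by (intro order_trans[OF C1(2)] mult_right_mono) auto
    show ?thesis
    proof (cases "insert v T \<in> F")
      case True
      have iT: "insert v T \<subseteq> C" using v(1) T(2) by auto
      obtain \<C>2 where C2: "\<C>2 \<subseteq> Pow C"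
        "real (card \<C>2) \<le> w powr (potential F C (insert v T) u / g) * (1 + 1 / w) ^ n"
        "\<forall>I\<in>F. insert v T \<subseteq> I \<and> I \<subseteq> C \<longrightarrow> (\<exists>D\<in>\<C>2. I \<subseteq> D)"
        "\<forall>D\<in>\<C>2. exp ((u - g) * real (card D)) \<le> partition_fun F D {} (exp u - 1)"
        using less.hyps[OF _ fin True iT, folded n_def, unfolded n, OF lessI]
        by (elim exE conjE) (rule that)
      have "w powr (potential F C (insert v T) u / g) \<le> w powr (potential F C T u / g - 1)"
        using v(2)[OF True] \<open>0 < g\<close> \<open>1 \<le> w\<close>
        by (intro powr_mono) (auto simp: field_simps)
      also have "\<dots> = ?b * (1 / w)" using \<open>1 \<le> w\<close> by (simp add: powr_diff)
      finally have "real (card \<C>2) \<le> ?b * (1 / w) * (1 + 1 / w) ^ n"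
        using \<open>1 \<le> w\<close> by (intro order_trans[OF C2(2)] mult_right_mono) auto
      then have "real (card \<C>1) + real (card \<C>2) \<le> ?b * (1 + 1 / w) ^ card (C - T)"
        using card1 unfolding n by (simp add: algebra_simps)
      then have "real (card (\<C>1 \<union> \<C>2)) \<le> ?b * (1 + 1 / w) ^ card (C - T)"
        using card_Un_le[of \<C>1 \<C>2] by linarith
      moreover have "\<exists>D\<in>\<C>1 \<union> \<C>2. I \<subseteq> D" if I: "I \<in> F" "T \<subseteq> I \<and> I \<subseteq> C" for I
      proof (cases "v \<in> I")
        case True
        then show ?thesis using I bspec[OF C2(3) I(1)] by auto
      next
        case False
        then have "I \<subseteq> C - {v}" using I(2) by blast
        then show ?thesis using I bspec[OF C1(3) I(1)] by auto
      qed
      moreover have "\<C>1 \<union> \<C>2 \<subseteq> Pow C" using C1(1) C2(1) by blast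
      moreover have "\<forall>D\<in>\<C>1 \<union> \<C>2. exp ((u - g) * real (card D)) \<le> partition_fun F D {} (exp u - 1)"
        using C1(4) C2(4) unfolding ball_Un by (rule conjI)
      ultimately show ?thesis by blast
    next
      case False
      have "?b * (1 + 1 / w) ^ n \<le> ?b * (1 + 1 / w) ^ card (C - T)"
        using \<open>1 \<le> w\<close> unfolding n by (intro mult_left_mono power_increasing) auto
      then have "real (card \<C>1) \<le> ?b * (1 + 1 / w) ^ card (C - T)" using card1 by linarith
      moreover have "\<exists>D\<in>\<C>1. I \<subseteq> D" if "I \<in> F" "T \<subseteq> I" "I \<subseteq> C" for I
      proof -
        have "v \<notin> I" using bspec[OF down that(1)] that(2) False by blast
        then show ?thesis using C1(3) that by blast
      qed
      moreover have "\<C>1 \<subseteq> Pow C" using C1(1) by blast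
      ultimately show ?thesis using C1(4) by blast
    qed
  qed
qed

section \<open>Containers with a large independence probability\<close>

lemma probability_eq_partition_fun:
  assumes "finite C" "p < 1"
  shows "random_subset_expectation C p (\<lambda>R. of_bool (R \<in> F)) =
    (1 - p) ^ card C * partition_fun F C {} (p / (1 - p))"
proof -
  have "random_subset_expectation C p (\<lambda>R. of_bool (R \<in> F)) =
      (\<Sum>R\<in>Pow C. (1 - p) ^ card C * ((p / (1 - p)) ^ card R * of_bool (R \<in> F)))"
    unfolding random_subset_expectation_def
  proof (rule sum.cong)
    fix R assume "R \<in> Pow C"
    then have "card C = card (C - R) + card R"
      using card_Diff_subset[of R C] card_mono[of C R] finite_subset[of R C] assms(1) by auto
    then have "(1 - p) ^ card C * (p / (1 - p)) ^ card R = p ^ card R * (1 - p) ^ card (C - R)"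
      using assms(2) by (simp add: power_add power_divide)
    then show "p ^ card R * (1 - p) ^ card (C - R) * of_bool (R \<in> F) =
        (1 - p) ^ card C * ((p / (1 - p)) ^ card R * of_bool (R \<in> F))" by simp
  qed simp
  also have "\<dots> = (1 - p) ^ card C * (\<Sum>R\<in>Pow C. (p / (1 - p)) ^ card R * of_bool (R \<in> F))"
    by (simp add: sum_distrib_left)
  also have "(\<Sum>R\<in>Pow C. (p / (1 - p)) ^ card R * of_bool (R \<in> F)) = partition_fun F C {} (p / (1 - p))"
    unfolding partition_fun_def
    by (rule sum.mono_neutral_cong_right) (use assms(1) in auto)
  finally show ?thesis .
qed

text \<open>Here \<open>u\<close> satisfies \<open>1 - exp (- u) = q\<close>, and \<open>w = 1 / q\<close> balances the two factors of the
  count: the second contributes only \<open>exp (q * card V)\<close>.\<close>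

lemma containers_by_independence_probability:
  assumes "finite V" "{} \<in> F" and down: "\<forall>A\<in>F. Pow A \<subseteq> F"
    and "0 < q" "q \<le> 1 / 2" "0 < g"
  shows "\<exists>\<C>. \<C> \<subseteq> Pow V \<and>
    real (card \<C>) \<le> exp (real (card V) * (4 * q\<^sup>2 / g * ln (1 / q) + q)) \<and>
    (\<forall>I\<in>F. I \<subseteq> V \<longrightarrow> (\<exists>C\<in>\<C>. I \<subseteq> C)) \<and>
    (\<forall>C\<in>\<C>. exp (- g * real (card C)) \<le> random_subset_expectation C q (\<lambda>R. of_bool (R \<in> F)))"
proof -
  define u where "u = - ln (1 - q)"
  have "- q - 2 * q\<^sup>2 \<le> ln (1 - q)"
    using ln_one_minus_pos_lower_bound[of q] assms(4,5) by simp
  moreover have "2 * q\<^sup>2 \<le> q"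
    using mult_left_mono[of "2 * q" 1 q] assms(4,5) by (simp add: power2_eq_square)
  ultimately have u: "0 \<le> u" "u \<le> 2 * q" using assms(4,5) by (auto simp: u_def)
  have eu: "exp u - 1 = q / (1 - q)" "exp (- u) = 1 - q"
    using assms(4,5) by (simp_all add: u_def exp_minus field_simps)
  have w: "1 \<le> 1 / q" using assms(4,5) by simp
  obtain \<C> where C: "\<C> \<subseteq> Pow V"
    "real (card \<C>) \<le> (1 / q) powr (potential F V {} u / g) * (1 + 1 / (1 / q)) ^ card (V - {})"
    "\<forall>I\<in>F. {} \<subseteq> I \<and> I \<subseteq> V \<longrightarrow> (\<exists>C\<in>\<C>. I \<subseteq> C)"
    "\<forall>C\<in>\<C>. exp ((u - g) * real (card C)) \<le> partition_fun F C {} (exp u - 1)"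
    using containers_above[OF down assms(1,2) empty_subsetI \<open>0 < g\<close> u(1) w]
    by (elim exE conjE) (rule that)
  have "potential F V {} u \<le> real (card V) * u\<^sup>2"
    by (rule potential_le) (use assms u in auto)
  also have "\<dots> \<le> real (card V) * (2 * q)\<^sup>2"
    using u by (intro mult_left_mono power_mono) auto
  finally have "potential F V {} u / g \<le> real (card V) * (4 * q\<^sup>2 / g)"
    using \<open>0 < g\<close> by (simp add: field_simps)
  then have "(1 / q) powr (potential F V {} u / g) \<le> (1 / q) powr (real (card V) * (4 * q\<^sup>2 / g))"
    using assms(4,5) by (intro powr_mono) auto
  also have "\<dots> = exp (real (card V) * (4 * q\<^sup>2 / g) * ln (1 / q))"
    using assms(4) by (simp add: powr_def)
  finally have "(1 / q) powr (potential F V {} u / g) * (1 + q) ^ card V \<le>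
      exp (real (card V) * (4 * q\<^sup>2 / g) * ln (1 / q)) * exp q ^ card V"
    using assms(4) by (intro mult_mono power_mono exp_ge_add_one_self) auto
  also have "\<dots> = exp (real (card V) * (4 * q\<^sup>2 / g * ln (1 / q) + q))"
    by (simp add: exp_of_nat_mult[symmetric] exp_add[symmetric] algebra_simps)
  finally have card: "real (card \<C>) \<le> exp (real (card V) * (4 * q\<^sup>2 / g * ln (1 / q) + q))"
    using C(2) by simp
  have "exp (- g * real (card C)) \<le> random_subset_expectation C q (\<lambda>R. of_bool (R \<in> F))"
    if "C \<in> \<C>" for C
  proof -
    have fin: "finite C" using that C(1) finite_subset[OF _ assms(1)] by blast
    have "exp (- g * real (card C)) = (1 - q) ^ card C * exp ((u - g) * real (card C))"
      unfolding eu(2)[symmetric] exp_of_nat_mult[symmetric] exp_add[symmetric]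
      by (simp add: algebra_simps)
    also have "\<dots> \<le> (1 - q) ^ card C * partition_fun F C {} (exp u - 1)"
      using C(4) that assms(5) by (intro mult_left_mono) auto
    also have "\<dots> = random_subset_expectation C q (\<lambda>R. of_bool (R \<in> F))"
      unfolding eu(1) by (rule probability_eq_partition_fun[symmetric]) (use fin assms(5) in auto)
    finally show ?thesis .
  qed
  then show ?thesis using C(1,3) card by (intro exI[of _ \<C>] conjI) simp_all
qed

section \<open>Dense subhypergraphs of bounded degree\<close>

text \<open>Edges are added greedily as long as no degree exceeds \<open>D\<close>; a rejected edge contains a vertex
  whose degree has reached \<open>D\<close>, and this remains so.\<close>

lemma ex_saturated_submultiset:
  fixes M :: "'a set multiset" and D :: nat
  shows "\<exists>N. N \<subseteq># M \<and> (\<forall>v. size {#A \<in># N. v \<in> A#} \<le> D) \<and>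
    (\<forall>A \<in># M - N. \<exists>v\<in>A. D \<le> size {#B \<in># N. v \<in> B#})"
proof (induction M)
  case empty
  show ?case by auto
next
  case (add A M)
  then obtain N where N: "N \<subseteq># M" "\<And>v. size {#A \<in># N. v \<in> A#} \<le> D"
    "\<And>A. A \<in># M - N \<Longrightarrow> \<exists>v\<in>A. D \<le> size {#B \<in># N. v \<in> B#}" by blast
  show ?case
  proof (cases "\<exists>v\<in>A. D \<le> size {#B \<in># N. v \<in> B#}")
    case True
    have "add_mset A M - N = add_mset A (M - N)"
      using multiset_diff_union_assoc[OF N(1), of "{#A#}"] by simp
    moreover have "N \<subseteq># add_mset A M"
      using N(1) by (rule subset_mset.order_trans) simp
    ultimately show ?thesis using N(2,3) True by (intro exI[of _ N]) auto
  next
    case False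
    then have "size {#B \<in># add_mset A N. v \<in> B#} \<le> D" for v
      using N(2)[of v] by (auto simp: not_le Suc_le_eq)
    moreover have "\<exists>v\<in>B. D \<le> size {#B \<in># add_mset A N. v \<in> B#}" if "B \<in># M - N" for B
      using N(3)[OF that] by (auto intro: le_SucI)
    ultimately show ?thesis using N(1) by (intro exI[of _ "add_mset A N"]) auto
  qed
qed

lemma sum_degrees:
  assumes "finite C" "\<And>A. A \<in># N \<Longrightarrow> A \<subseteq> C"
  shows "(\<Sum>v\<in>C. size {#A \<in># N. v \<in> A#}) = (\<Sum>A\<in>#N. card A)"
  using assms(2)
proof (induction N)
  case empty
  show ?case by simp
next
  case (add A N)
  have "(\<Sum>v\<in>C. size {#B \<in># add_mset A N. v \<in> B#}) =
      (\<Sum>v\<in>C. of_bool (v \<in> A) + size {#B \<in># N. v \<in> B#})"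
    by (rule sum.cong) auto
  also have "\<dots> = card (C \<inter> A) + (\<Sum>v\<in>C. size {#B \<in># N. v \<in> B#})"
    using assms(1) by (simp add: sum.distrib Int_def)
  also have "C \<inter> A = A" using add.prems by auto
  finally show ?case using add by simp
qed

text \<open>Take \<open>N\<close> from the greedy construction, and let \<open>S\<close> be the set of vertices of degree
  \<open>D\<close>. Every edge that avoids \<open>S\<close> belongs to \<open>N\<close>. If \<open>S\<close> is small, then \<open>C - S\<close> is large
  and the edges inside it suffice; if \<open>S\<close> is large, then the degrees of its vertices alone force
  \<open>N\<close> to have enough edges.\<close>

lemma ex_dense_bounded_degree:
  fixes M :: "'a set multiset" and D s :: nat and \<beta> E :: real
  assumes "finite C" "\<And>A. A \<in># M \<Longrightarrow> A \<subseteq> C \<and> card A = s" "1 \<le> s"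
    and D: "real s * E \<le> real D * (\<beta> * real (card C))"
    and W: "\<And>W. W \<subseteq> C \<Longrightarrow> (1 - \<beta>) * real (card C) \<le> real (card W) \<Longrightarrow>
      E \<le> real (size {#A \<in># M. A \<subseteq> W#})"
  shows "\<exists>N. N \<subseteq># M \<and> E \<le> real (size N) \<and> (\<forall>v. size {#A \<in># N. v \<in> A#} \<le> D)"
proof -
  obtain N where N: "N \<subseteq># M" "\<And>v. size {#A \<in># N. v \<in> A#} \<le> D"
    "\<And>A. A \<in># M - N \<Longrightarrow> \<exists>v\<in>A. D \<le> size {#B \<in># N. v \<in> B#}"
    using ex_saturated_submultiset[of M D] by blast
  define S where "S = {v \<in> C. D \<le> size {#B \<in># N. v \<in> B#}}"
  have S: "S \<subseteq> C" by (auto simp: S_def)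
  have N_edge: "A \<subseteq> C" "card A = s" if "A \<in># N" for A
    using assms(2) mset_subset_eqD[OF N(1) that] by auto
  have "E \<le> real (size N)"
  proof (cases "real (card S) \<le> \<beta> * real (card C)")
    case True
    have "real (card (C - S)) = real (card C) - real (card S)"
      using card_Diff_subset[OF finite_subset[OF S assms(1)] S] card_mono[OF assms(1) S] by simp
    then have "E \<le> real (size {#A \<in># M. A \<subseteq> C - S#})"
      using True by (intro W) (auto simp: algebra_simps)
    also have "{#A \<in># M. A \<subseteq> C - S#} = {#A \<in># N. A \<subseteq> C - S#}"
    proof -
      have "{#A \<in># M - N. A \<subseteq> C - S#} = {#}"
      proof -
        have "\<not> A \<subseteq> C - S" if A: "A \<in># M - N" for A
        proof
          assume "A \<subseteq> C - S"
          moreover obtain v where "v \<in> A" "D \<le> size {#B \<in># N. v \<in> B#}"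
            using N(3)[OF A] by blast
          ultimately show False by (auto simp: S_def)
        qed
        then have "set_mset {#A \<in># M - N. A \<subseteq> C - S#} = {}" unfolding set_mset_filter by blast
        then show ?thesis by (simp only: set_mset_eq_empty_iff)
      qed
      moreover have "M = N + (M - N)" using N(1) by simp
      ultimately show ?thesis by (metis add.right_neutral filter_union_mset)
    qed
    also have "size \<dots> \<le> size N" by (rule size_filter_mset_lesseq)
    finally show ?thesis by simp
  next
    case False
    have "D * card S = (\<Sum>v\<in>S. D)" by simp
    also have "\<dots> \<le> (\<Sum>v\<in>S. size {#B \<in># N. v \<in> B#})"
      by (rule sum_mono) (simp add: S_def)
    also have "\<dots> \<le> (\<Sum>v\<in>C. size {#B \<in># N. v \<in> B#})"
      by (rule sum_mono2) (use assms(1) S in auto)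
    also have "\<dots> = (\<Sum>A\<in>#N. card A)"
      by (rule sum_degrees) (use assms(1) N_edge in auto)
    also have "\<dots> = (\<Sum>A\<in>#N. s)"
      by (intro arg_cong[of _ _ sum_mset] image_mset_cong) (use N_edge in auto)
    finally have "D * card S \<le> s * size N" by (simp add: mult.commute)
    then have "real D * real (card S) \<le> real s * real (size N)"
      by (metis of_nat_le_iff of_nat_mult)
    moreover have "real D * (\<beta> * real (card C)) \<le> real D * real (card S)"
      using False by (intro mult_left_mono) auto
    ultimately have "real s * E \<le> real s * real (size N)" using D by linarith
    then show ?thesis using assms(3) by simp
  qed
  then show ?thesis using N by blast
qed

section \<open>Degree bounds and the correlation of edges\<close>

text \<open>Each \<open>B\<close> on the left is accounted for on the right by the single term \<open>T = B \<inter> A\<close>, since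
  \<open>card (B - A) = s - card T\<close>.\<close>

lemma sum_neighbours_le_codegrees:
  fixes p :: real
  assumes "finite A" "0 < p" "\<And>B. B \<in># N \<Longrightarrow> finite B \<and> card B = s"
  shows "(\<Sum>B\<in>#{#B \<in># N. B \<inter> A \<noteq> {}#}. p ^ card (B - A)) \<le>
    p ^ s * (\<Sum>T\<in>Pow A - {{}}. (1 / p) ^ card T * real (size {#B \<in># N. T \<subseteq> B#}))"
  using assms(3)
proof (induction N)
  case empty
  show ?case by simp
next
  case (add B N)
  let ?P = "Pow A - {{}}"
  have B: "finite B" "card B = s" using add.prems by auto
  have "(if B \<inter> A \<noteq> {} then p ^ card (B - A) else 0) \<le>
      p ^ s * (\<Sum>T\<in>?P. (1 / p) ^ card T * of_bool (T \<subseteq> B))" (is "?l \<le> ?r")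
  proof (cases "B \<inter> A = {}")
    case True
    have "0 \<le> ?r" using assms(2) by (intro mult_nonneg_nonneg sum_nonneg) auto
    then show ?thesis using True by simp
  next
    case False
    have "s = card (B - A) + card (B \<inter> A)"
      using card_Int_Diff[OF B(1), of A] B(2) by simp
    then have "p ^ card (B - A) = p ^ s * (1 / p) ^ card (B \<inter> A)"
      using assms(2) by (simp add: power_add power_one_over)
    also have "\<dots> \<le> ?r"
    proof (intro mult_left_mono)
      have "(1 / p) ^ card (B \<inter> A) * of_bool (B \<inter> A \<subseteq> B) \<le>
          (\<Sum>T\<in>?P. (1 / p) ^ card T * of_bool (T \<subseteq> B))"
        by (rule member_le_sum) (use assms(1,2) False in auto)
      then show "(1 / p) ^ card (B \<inter> A) \<le> (\<Sum>T\<in>?P. (1 / p) ^ card T * of_bool (T \<subseteq> B))"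
        by simp
    qed (use assms(2) in auto)
    finally show ?thesis using False by simp
  qed
  moreover have "(\<Sum>B\<in>#{#B \<in># N. B \<inter> A \<noteq> {}#}. p ^ card (B - A)) \<le>
      p ^ s * (\<Sum>T\<in>?P. (1 / p) ^ card T * real (size {#B \<in># N. T \<subseteq> B#}))"
    using add by auto
  moreover have *: "(\<Sum>T\<in>?P. (1 / p) ^ card T * real (size {#B' \<in># add_mset B N. T \<subseteq> B'#})) =
      (\<Sum>T\<in>?P. (1 / p) ^ card T * of_bool (T \<subseteq> B)) +
      (\<Sum>T\<in>?P. (1 / p) ^ card T * real (size {#B \<in># N. T \<subseteq> B#}))"
    unfolding sum.distrib[symmetric] by (rule sum.cong) (auto simp: algebra_simps)
  ultimately show ?case
    unfolding * by (cases "B \<inter> A = {}") (simp_all add: distrib_left)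
qed

text \<open>The sum is \<open>((1 + k) ^ card A - 1) / k\<close>. It stays linear in \<open>card A\<close> as long as
  \<open>card A * k \<le> 1\<close>; this is what keeps the dependence on the uniformity polynomial.\<close>

lemma sum_nonempty_subsets_le:
  fixes k :: real
  assumes "finite A" "0 < k" "real (card A) * k \<le> 1"
  shows "(\<Sum>T\<in>Pow A - {{}}. k ^ (card T - 1)) \<le> 2 * real (card A)"
proof -
  have "k * (\<Sum>T\<in>Pow A - {{}}. k ^ (card T - 1)) = (\<Sum>T\<in>Pow A - {{}}. k ^ card T)"
    unfolding sum_distrib_left
  proof (rule sum.cong)
    fix T assume "T \<in> Pow A - {{}}"
    then have "card T \<noteq> 0" using finite_subset[OF _ assms(1)] by auto
    then show "k * k ^ (card T - 1) = k ^ card T" by (simp add: power_eq_if)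
  qed simp
  also have "\<dots> = (\<Sum>T\<in>Pow A. k ^ card T) - 1"
    using assms(1) by (subst sum_diff) auto
  also have "(\<Sum>T\<in>Pow A. k ^ card T) = (1 + k) ^ card A"
    using sum_power_card_Pow[OF assms(1), of k 1] by (simp add: add.commute)
  also have "(1 + k) ^ card A \<le> exp k ^ card A"
    using assms(2) by (intro power_mono exp_ge_add_one_self) auto
  also have "\<dots> = exp (real (card A) * k)" by (simp add: exp_of_nat_mult)
  also have "\<dots> \<le> 1 + real (card A) * k + (real (card A) * k)\<^sup>2"
    using assms by (intro exp_bound) auto
  also have "\<dots> \<le> 1 + real (card A) * k + real (card A) * k"
    using mult_left_mono[OF assms(3), of "real (card A) * k"] assms(2)
    unfolding power2_eq_square mult_1_right by (intro add_left_mono) auto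
  finally have "k * (\<Sum>T\<in>Pow A - {{}}. k ^ (card T - 1)) \<le> k * (2 * real (card A))"
    by (simp add: algebra_simps)
  then show ?thesis using assms(2) by simp
qed

text \<open>In Janson's inequality for this hypergraph, the \<open>L\<close> of the neighbourhood sums is
  \<open>2 * s * D * p ^ (s - 1)\<close> and the expected number of edges is \<open>size N * p ^ s\<close>, so the powers of
  \<open>p\<close> cancel except for one.\<close>

lemma independence_probability_le:
  fixes p k D :: real and s :: nat
  assumes "finite C" "N \<noteq> {#}" "1 \<le> s" "0 < p" "p \<le> 1" "0 < k" "real s * k \<le> 1" "0 \<le> D"
    and N: "\<And>A. A \<in># N \<Longrightarrow> A \<subseteq> C \<and> card A = s"
    and codegree: "\<And>A T. A \<in># N \<Longrightarrow> T \<subseteq> A \<Longrightarrow> T \<noteq> {} \<Longrightarrow>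
      real (size {#B \<in># N. T \<subseteq> B#}) \<le> (p * k) ^ (card T - 1) * D"
  shows "random_subset_expectation C p (\<lambda>R. of_bool (\<forall>A\<in>#N. \<not> A \<subseteq> R)) \<le>
    exp (- real (size N) * p / (8 * real s * D))"
proof -
  define L where "L = p ^ s * (2 * real s * (D / p))"
  have fin: "finite A" if "A \<in># N" for A using N[OF that] assms(1) finite_subset by auto
  have neighbours: "(\<Sum>B\<in>#{#B \<in># N. B \<inter> A \<noteq> {}#}. p ^ card (B - A)) \<le> L" if A: "A \<in># N" for A
  proof -
    have "(\<Sum>B\<in>#{#B \<in># N. B \<inter> A \<noteq> {}#}. p ^ card (B - A)) \<le>
        p ^ s * (\<Sum>T\<in>Pow A - {{}}. (1 / p) ^ card T * real (size {#B \<in># N. T \<subseteq> B#}))"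
      by (rule sum_neighbours_le_codegrees) (use A N fin assms(4) in auto)
    also have "\<dots> \<le> p ^ s * (\<Sum>T\<in>Pow A - {{}}. k ^ (card T - 1) * (D / p))"
    proof (intro mult_left_mono sum_mono)
      fix T assume T: "T \<in> Pow A - {{}}"
      then have "finite T" using fin[OF A] finite_subset by auto
      then have t: "card T = Suc (card T - 1)" using T by (simp add: card_gt_0_iff)
      have "(1 / p) ^ card T * real (size {#B \<in># N. T \<subseteq> B#}) \<le>
          (1 / p) ^ card T * ((p * k) ^ (card T - 1) * D)"
        using codegree[OF A, of T] T assms(4) by (intro mult_left_mono) auto
      also have "\<dots> = k ^ (card T - 1) * (D / p)"
        by (subst t) (use assms(4) in \<open>simp add: power_mult_distrib power_one_over\<close>)
      finally show "(1 / p) ^ card T * real (size {#B \<in># N. T \<subseteq> B#}) \<le> k ^ (card T - 1) * (D / p)" .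
    qed (use assms(4) in auto)
    also have "\<dots> \<le> L"
      unfolding L_def sum_distrib_right[symmetric]
      using sum_nonempty_subsets_le[of A k] N[OF A] fin[OF A] assms
      by (intro mult_left_mono mult_right_mono) auto
    finally show ?thesis .
  qed
  obtain A where A: "A \<in># N" using assms(2) by (meson multiset_nonemptyE)
  have "A \<noteq> {}" using N[OF A] assms(3) by auto
  then obtain N' where "{#B \<in># N. B \<inter> A \<noteq> {}#} = add_mset A N'"
    using A multi_member_split[of A "{#B \<in># N. B \<inter> A \<noteq> {}#}"] by auto
  moreover have "0 \<le> (\<Sum>B\<in>#N'. p ^ card (B - A))"
    using assms(4) by (induction N') auto
  ultimately have "1 \<le> (\<Sum>B\<in>#{#B \<in># N. B \<inter> A \<noteq> {}#}. p ^ card (B - A))" by simp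
  then have "1 \<le> L" using neighbours[OF A] by linarith
  then have "random_subset_expectation C p (\<lambda>R. of_bool (\<forall>A\<in>#N. \<not> A \<subseteq> R)) \<le>
      exp (- (\<Sum>A\<in>#N. p ^ card A) / (4 * L))"
    using assms neighbours by (intro Janson_inequality) auto
  also have "(\<Sum>A\<in>#N. p ^ card A) = (\<Sum>A\<in>#N. p ^ s)"
    by (intro arg_cong[of _ _ sum_mset] image_mset_cong) (use N in auto)
  also have "- (\<Sum>A\<in>#N. p ^ s) / (4 * L) = - real (size N) * p / (8 * real s * D)"
    using assms(4) by (simp add: L_def)
  finally show ?thesis .
qed

section \<open>Independence probabilities in dense hypergraphs\<close>

lemma degree_le_max_degree:
  assumes "finite (vertices H)" "T \<subseteq> vertices H"
  shows "degree H T \<le> max_degree (card T) H"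
  unfolding max_degree_def by (rule Max_ge) (use assms in auto)

text \<open>The bounds on the degrees of sets with at least two vertices are assumptions; the missing bound on
  vertex degrees comes from passing to the subhypergraph \<open>N\<close>. Its maximum degree \<open>D\<close> is at
  least \<open>E / num_vertices H\<close>, so all these bounds have the common form
  \<open>(q * k) ^ (card T - 1) * D\<close>.\<close>

lemma dense_imp_independence_probability_le:
  fixes H :: "'a hypergraph" and \<beta> q k E :: real
  assumes H: "uniform_hypergraph s H" and s: "1 \<le> s" and C: "C \<subseteq> vertices H" "C \<noteq> {}"
    and \<beta>: "0 < \<beta>" "\<beta> \<le> 1" and q: "0 < q" "q \<le> 1" and k: "0 < k" "real s * k \<le> 1"
    and E: "real (num_vertices H) \<le> E"
    and codegree: "\<And>t. t \<in> {2..s} \<Longrightarrow>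
      real (max_degree t H) \<le> (q * k) ^ (t - 1) * (E / real (num_vertices H))"
    and dense: "\<And>W. W \<subseteq> C \<Longrightarrow> (1 - \<beta>) * real (card C) \<le> real (card W) \<Longrightarrow>
      E \<le> real (num_edges (induced H W))"
  shows "random_subset_expectation C q (\<lambda>R. of_bool (R \<in> independent_sets H)) \<le>
    exp (- q * \<beta> / (16 * (real s)\<^sup>2) * real (card C))"
proof -
  let ?V = "vertices H" and ?c = "real (card C)"
  have V: "finite ?V" and edge: "\<And>A. A \<in># edges H \<Longrightarrow> A \<subseteq> ?V \<and> card A = s"
    using H by (auto simp: uniform_hypergraph_def hypergraph_def)
  have fin: "finite C" by (rule finite_subset[OF C(1) V])
  have c: "1 \<le> ?c" using C(2) fin by (simp add: Suc_le_eq card_gt_0_iff)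
  have cV: "?c \<le> real (num_vertices H)"
    unfolding num_vertices_def using card_mono[OF V C(1)] by simp
  have s': "1 \<le> real s" using s by simp
  have \<beta>c: "0 < \<beta> * ?c" "\<beta> * ?c \<le> real (num_vertices H)"
  proof -
    show "0 < \<beta> * ?c" using \<beta>(1) c by (intro mult_pos_pos) auto
    have "\<beta> * ?c \<le> 1 * ?c" using \<beta>(2) by (intro mult_right_mono) auto
    then show "\<beta> * ?c \<le> real (num_vertices H)" using cV by linarith
  qed
  define x where "x = real s * E / (\<beta> * ?c)"
  define D where "D = nat \<lceil>x\<rceil>"
  have sE: "E \<le> real s * E" using s' E cV c mult_right_mono[of 1 "real s" E] by simp
  \<comment> \<open>As \<open>x \<ge> 1\<close>, rounding up to an integer degree costs at most a factor 2.\<close>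
  have x1: "1 \<le> x"
  proof -
    have "\<beta> * ?c \<le> real s * E" using \<beta>c(2) sE E by linarith
    then show ?thesis using \<beta>c(1) unfolding x_def by simp
  qed
  then have D: "x \<le> real D" "real D \<le> 2 * x"
    unfolding D_def by linarith+
  have xE: "E / real (num_vertices H) \<le> x"
    unfolding x_def using \<beta>c sE E cV c by (intro frac_le) auto
  define M where "M = {#A \<in># edges H. A \<subseteq> C#}"
  have M: "A \<subseteq> C \<and> card A = s" if "A \<in># M" for A
    using that edge by (auto simp: M_def)
  have "E \<le> real (size {#A \<in># M. A \<subseteq> W#})" if "W \<subseteq> C" "(1 - \<beta>) * ?c \<le> real (card W)" for W
  proof -
    have "{#A \<in># M. A \<subseteq> W#} = edges (induced H W)"
      unfolding M_def induced_def using that(1) by (auto simp: filter_filter_mset intro!: filter_mset_cong)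
    then show ?thesis using dense[OF that] by (simp add: num_edges_def)
  qed
  moreover have "real s * E \<le> real D * (\<beta> * ?c)"
    using D(1) \<beta>c(1) unfolding x_def by (simp add: divide_le_eq)
  ultimately obtain N where N: "N \<subseteq># M" "E \<le> real (size N)"
    "\<And>v. size {#A \<in># N. v \<in> A#} \<le> D"
    using ex_dense_bounded_degree[OF fin M s, of M E D \<beta>] by blast
  have NM: "A \<in># M" if "A \<in># N" for A by (rule mset_subset_eqD[OF N(1) that])
  have NH: "N \<subseteq># edges H"
    by (rule subset_mset.order_trans[OF N(1)]) (simp add: M_def)
  have "random_subset_expectation C q (\<lambda>R. of_bool (R \<in> independent_sets H)) \<le>
      random_subset_expectation C q (\<lambda>R. of_bool (\<forall>A\<in>#N. \<not> A \<subseteq> R))"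
    using q mset_subset_eqD[OF NH]
    by (intro expectation_mono) (auto simp: independent_sets_def)
  also have "\<dots> \<le> exp (- real (size N) * q / (8 * real s * real D))"
  proof (rule independence_probability_le[OF fin _ s q k])
    show "N \<noteq> {#}" using N(2) E cV c by auto
    show "A \<subseteq> C \<and> card A = s" if "A \<in># N" for A using M NM that by blast
    fix A T assume A: "A \<in># N" and T: "T \<subseteq> A" "T \<noteq> {}"
    have finA: "finite A" and Cs: "A \<subseteq> C" "card A = s"
      using M[OF NM[OF A]] fin finite_subset by auto
    have finT: "finite T" by (rule finite_subset[OF T(1) finA])
    show "real (size {#B \<in># N. T \<subseteq> B#}) \<le> (q * k) ^ (card T - 1) * real D"
    proof (cases "card T = 1")
      case True
      then obtain v where "T = {v}" by (auto simp: card_1_singleton_iff)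
      then show ?thesis using N(3)[of v] by simp
    next
      case False
      then have t: "card T \<in> {2..s}"
      proof -
        have "card T \<noteq> 0" using T(2) finT by simp
        moreover have "card T \<le> s" using card_mono[OF finA T(1)] Cs(2) by simp
        ultimately show ?thesis using False by simp
      qed
      have "size {#B \<in># N. T \<subseteq> B#} \<le> degree H T"
        unfolding degree_def by (intro size_mset_mono multiset_filter_mono NH)
      also have "\<dots> \<le> max_degree (card T) H"
        by (rule degree_le_max_degree[OF V]) (use T Cs C in blast)
      finally have "real (size {#B \<in># N. T \<subseteq> B#}) \<le> (q * k) ^ (card T - 1) * (E / real (num_vertices H))"
        using codegree[OF t] by linarith
      also have "\<dots> \<le> (q * k) ^ (card T - 1) * real D"
        using q k xE D(1) by (intro mult_left_mono) auto
      finally show ?thesis .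
    qed
  qed simp
  also have "\<dots> \<le> exp (- q * \<beta> / (16 * (real s)\<^sup>2) * ?c)"
  proof -
    have Epos: "0 < E" using E cV c by linarith
    have Dpos: "0 < real D" using D(1) x1 by linarith
    have "q * \<beta> / (16 * (real s)\<^sup>2) * ?c = E * q / (8 * real s * (2 * x))"
      unfolding x_def using Epos \<beta>c(1) s' by (simp add: field_simps power2_eq_square)
    also have "\<dots> \<le> real (size N) * q / (8 * real s * real D)"
      using N(2) D(2) Dpos Epos q s' by (intro frac_le mult_right_mono mult_left_mono) auto
    finally show ?thesis by simp
  qed
  finally show ?thesis .
qed

section \<open>The efficient container lemma\<close>

theorem theorem1p6:
  fixes s :: nat and H :: "'a hypergraph" and \<alpha> \<beta> q E :: real
  assumes "s \<ge> 1"
    and "uniform_hypergraph s H"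
    and "nonempty_hypergraph H"
    and "0 < \<alpha>" and "\<alpha> < 1"
    and "0 < \<beta>" and "\<beta> < 1"
    and "0 < q" and "q < 1"
    and "E \<ge> real (num_vertices H)"
    and "\<alpha> * \<beta> * q * real (num_vertices H) \<ge> 10 ^ 9 * real s ^ 7"
    and "10 ^ 4 * real s ^ 5 * q \<le> \<beta>"
    and "\<And>t. t \<in> {2..s} \<Longrightarrow>
      real (max_degree t H) \<le> (q / (10 ^ 6 * real s ^ 5)) ^ (t - 1) * (E / real (num_vertices H))"
  shows "\<exists>\<C>. \<C> \<subseteq> Pow (vertices H) \<and>
    real (card \<C>) \<le> exp (10 ^ 4 * real s ^ 5 * inverse \<beta> * ln (exp 1 / \<alpha>) * (q * ln (exp 1 / q))
      * real (num_vertices H)) \<and>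
    (\<forall>I \<in> independent_sets H. \<exists>C \<in> \<C>. I \<subseteq> C) \<and>
    (\<forall>C \<in> \<C>. real (card C) \<le> \<alpha> * real (num_vertices H) \<or>
      (\<exists>W \<subseteq> C. real (card W) \<ge> (1 - \<beta>) * real (card C) \<and> real (num_edges (induced H W)) < E))"
proof -
  \<comment> \<open>Half the exponential rate at which the independence probability decays on dense sets.\<close>
  define g where "g = q * \<beta> / (32 * (real s)\<^sup>2)"
  let ?v = "real (num_vertices H)" and ?F = "independent_sets H"
  have V: "finite (vertices H)" and edge: "\<And>A. A \<in># edges H \<Longrightarrow> card A = s"
    using assms(2) by (auto simp: uniform_hypergraph_def hypergraph_def)
  have s: "1 \<le> real s" "1 \<le> real s ^ 5" using assms(1) by auto
  have g: "0 < g" unfolding g_def using assms(6,8) s by (intro divide_pos_pos mult_pos_pos) auto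
  have q: "q \<le> 1 / 2"
  proof -
    have "10 ^ 4 * 1 * q \<le> 10 ^ 4 * real s ^ 5 * q"
      using s assms(8) by (intro mult_right_mono mult_left_mono) auto
    then show ?thesis using assms(7,12) by simp
  qed
  have empty: "{} \<in> ?F" using edge assms(1) by (force simp: independent_sets_def)
  have down: "\<forall>A\<in>?F. Pow A \<subseteq> ?F" by (fastforce simp: independent_sets_def)
  obtain \<C> where C: "\<C> \<subseteq> Pow (vertices H)"
    "real (card \<C>) \<le> exp (real (card (vertices H)) * (4 * q\<^sup>2 / g * ln (1 / q) + q))"
    "\<forall>I\<in>?F. I \<subseteq> vertices H \<longrightarrow> (\<exists>C\<in>\<C>. I \<subseteq> C)"
    "\<forall>C\<in>\<C>. exp (- g * real (card C)) \<le> random_subset_expectation C q (\<lambda>R. of_bool (R \<in> ?F))"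
    using containers_by_independence_probability[OF V empty down assms(8) q g] by (elim exE conjE) (rule that)
  have card: "real (card \<C>) \<le> exp (10 ^ 4 * real s ^ 5 * inverse \<beta> * ln (exp 1 / \<alpha>) * (q * ln (exp 1 / q)) * ?v)"
  proof -
    define a where "a = 10 ^ 4 * real s ^ 5 * inverse \<beta>"
    have l: "0 \<le> ln (1 / q)" "ln (exp 1 / q) = ln (1 / q) + 1" "1 \<le> ln (exp 1 / \<alpha>)"
      using assms(4,5,8,9) by (auto simp: ln_div)
    have "128 * (real s)\<^sup>2 \<le> 10 ^ 4 * real s ^ 5"
      using power_increasing[of 2 5 "real s"] s by (intro mult_mono) auto
    then have "128 * (real s)\<^sup>2 / \<beta> \<le> 10 ^ 4 * real s ^ 5 / \<beta>"
      using assms(6) by (intro divide_right_mono) auto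
    moreover have "4 * q\<^sup>2 / g = 128 * (real s)\<^sup>2 / \<beta> * q"
      using assms(6,8) s by (simp add: g_def power2_eq_square field_simps)
    ultimately have 1: "4 * q\<^sup>2 / g \<le> a * q"
      using assms(8) by (simp add: a_def divide_inverse mult_right_mono)
    have "1 * 1 \<le> (10 ^ 4 * real s ^ 5) * inverse \<beta>"
    proof (rule mult_mono)
      show "1 \<le> 10 ^ 4 * real s ^ 5"
        using mult_mono[of 1 "10 ^ 4" 1 "real s ^ 5"] s(2) by simp
    qed (use assms(6,7) in \<open>auto simp: one_le_inverse\<close>)
    then have 2: "1 \<le> a" by (simp add: a_def)
    have "4 * q\<^sup>2 / g * ln (1 / q) + q \<le> a * q * ln (1 / q) + a * q"
      using 1 2 l(1) assms(8) mult_right_mono[of 1 a q] by (intro add_mono mult_right_mono) auto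
    also have "\<dots> = a * 1 * (q * ln (exp 1 / q))" unfolding l(2) by (simp add: algebra_simps)
    also have "\<dots> \<le> a * ln (exp 1 / \<alpha>) * (q * ln (exp 1 / q))"
      using 2 l assms(8) by (intro mult_right_mono mult_left_mono) auto
    finally have "?v * (4 * q\<^sup>2 / g * ln (1 / q) + q) \<le> a * ln (exp 1 / \<alpha>) * (q * ln (exp 1 / q)) * ?v"
      using mult_left_mono[of _ _ ?v] by (simp add: mult.commute[of ?v])
    then show ?thesis using C(2) unfolding a_def num_vertices_def by (smt (verit) exp_le_cancel_iff)
  qed
  have "\<exists>W\<subseteq>C. real (card W) \<ge> (1 - \<beta>) * real (card C) \<and> real (num_edges (induced H W)) < E"
    if CC: "C \<in> \<C>" "C \<noteq> {}" for C
  proof (rule ccontr)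
    assume no: "\<not> ?thesis"
    have CV: "C \<subseteq> vertices H" using CC C(1) by auto
    then have c: "0 < real (card C)" using CC(2) V finite_subset by (auto simp: card_gt_0_iff)
    define k where "k = 1 / (10 ^ 6 * real s ^ 5)"
    have "1 * real s \<le> 10 ^ 6 * real s ^ 5"
      using power_increasing[of 1 5 "real s"] s by (intro mult_mono) auto
    then have k: "0 < k" "real s * k \<le> 1" using s by (auto simp: k_def field_simps)
    have "random_subset_expectation C q (\<lambda>R. of_bool (R \<in> ?F)) \<le>
        exp (- q * \<beta> / (16 * (real s)\<^sup>2) * real (card C))"
    proof (rule dense_imp_independence_probability_le[OF assms(2,1) CV CC(2) assms(6) _ assms(8) _ k assms(10)])
      show "real (max_degree t H) \<le> (q * k) ^ (t - 1) * (E / ?v)" if "t \<in> {2..s}" for t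
        using assms(13)[OF that] by (simp add: k_def)
      show "E \<le> real (num_edges (induced H W))"
        if "W \<subseteq> C" "(1 - \<beta>) * real (card C) \<le> real (card W)" for W
        using no that by (meson not_less)
    qed (use assms in auto)
    also have "- q * \<beta> / (16 * (real s)\<^sup>2) = - (2 * g)" by (simp add: g_def)
    also have "exp (- (2 * g) * real (card C)) < exp (- g * real (card C))"
      using g c by simp
    also have "\<dots> \<le> random_subset_expectation C q (\<lambda>R. of_bool (R \<in> ?F))" using C(4) CC by blast
    finally show False by simp
  qed
  moreover have "real (card {}) \<le> \<alpha> * ?v" using assms(4) by simp
  ultimately have "real (card C) \<le> \<alpha> * ?v \<or>
      (\<exists>W\<subseteq>C. real (card W) \<ge> (1 - \<beta>) * real (card C) \<and> real (num_edges (induced H W)) < E)"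
    if "C \<in> \<C>" for C using that by (cases "C = {}") simp_all
  moreover have "\<exists>C\<in>\<C>. I \<subseteq> C" if "I \<in> ?F" for I
    using C(3) that by (auto simp: independent_sets_def)
  ultimately show ?thesis using C(1) card by (intro exI[of _ \<C>] conjI ballI) blast+
qed

end
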